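(* For infinitely many dimensions $d$, every one-pass monotonic deterministic streaming algorithm for the streaming ellipsoidal approximation problem in $\mathbb{R}^d$ has approximation factor to the minimum volume outer ellipsoid of at least $\sqrt{d}$.
   Context: Streaming ellipsoidal approximation problem: points $x_1,\dots,x_n\in\mathbb{R}^d$ arrive one by one ($n$ possibly unknown in advance); after receiving $x_t$ the algorithm outputs an origin-centered ellipsoid $\mathcal{E}_t$ with $X_t:=\mathrm{conv}\{\pm x_1,\dots,\pm x_t\}\subseteq\mathcal{E}_t$. The algorithm is monotonic if additionally $\mathcal{E}_t\subseteq\mathcal{E}_{t+1}$ for all $t$. For $X=X_n$, let $J(X)$ denote the minimum-volume (origin-centered) ellipsoid containing $X$. The algorithm's approximation factor to the minimum volume outer ellipsoid is the infimum of $\alpha$ such that on every input stream its final output satisfies $\mathcal{E}_n\subseteq\alpha\cdot J(X)$. *)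

theory Defs
  imports
    "HOL-Analysis.Lebesgue_Measure"
    "Jordan_Normal_Form.VS_Connect"
begin

text \<open>
  The dimension is quantified inside the theorem, so the Euclidean space of dimension d is the
  carrier set carrier_vec d of the type of real vectors, rather than a type of its own.
\<close>

definition unit_ball_vec :: "nat \<Rightarrow> real vec set" where
  "unit_ball_vec d = {x \<in> carrier_vec d. x \<bullet> x \<le> 1}"

text \<open>
  Singular matrices are allowed, so flat ellipsoids are included: a streaming algorithm may
  output them as long as the points seen so far lie in a proper subspace.
\<close>

definition ellipsoid :: "nat \<Rightarrow> real vec set \<Rightarrow> bool" where
  "ellipsoid d E \<longleftrightarrow> (\<exists>M \<in> carrier_mat d d. E = (\<lambda>x. M *\<^sub>v x) ` unit_ball_vec d)"

definition convex_vec :: "nat \<Rightarrow> real vec set \<Rightarrow> bool" where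
  "convex_vec d C \<longleftrightarrow> C \<subseteq> carrier_vec d \<and>
     (\<forall>x\<in>C. \<forall>y\<in>C. \<forall>u\<ge>0. \<forall>v\<ge>0. u + v = 1 \<longrightarrow> u \<cdot>\<^sub>v x + v \<cdot>\<^sub>v y \<in> C)"

definition sym_hull :: "nat \<Rightarrow> real vec list \<Rightarrow> real vec set" where
  "sym_hull d xs = convex_vec d hull (set xs \<union> uminus ` set xs)"

text \<open>
  Lebesgue measure in dimension d: the d-fold product of the Lebesgue-Borel measure on the
  line, transported along the coordinate bijection between vectors and extensional functions
  on {..<d}. Ellipsoids are compact, hence measurable for it.
\<close>

definition vec_volume :: "nat \<Rightarrow> real vec set \<Rightarrow> ennreal" where
  "vec_volume d S = emeasure (\<Pi>\<^sub>M i\<in>{..<d}. lborel) {f \<in> {..<d} \<rightarrow>\<^sub>E UNIV. vec d f \<in> S}"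

definition is_min_volume_ellipsoid :: "nat \<Rightarrow> real vec set \<Rightarrow> real vec set \<Rightarrow> bool" where
  "is_min_volume_ellipsoid d X J \<longleftrightarrow> ellipsoid d J \<and> X \<subseteq> J \<and>
     (\<forall>E. ellipsoid d E \<and> X \<subseteq> E \<longrightarrow> vec_volume d J \<le> vec_volume d E)"

text \<open>
  The minimizer exists and is unique (Loewner-John) when X is the symmetric hull of finitely
  many vectors spanning the space; the definition is only applied to such X.
\<close>

definition min_volume_ellipsoid :: "nat \<Rightarrow> real vec set \<Rightarrow> real vec set" where
  "min_volume_ellipsoid d X = (THE J. is_min_volume_ellipsoid d X J)"

definition spanning :: "nat \<Rightarrow> real vec set \<Rightarrow> bool" where
  "spanning d S \<longleftrightarrow>
     LinearCombinations.module.span class_ring (module_vec TYPE(real) d) S = carrier_vec d"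

text \<open>
  A deterministic one-pass algorithm is identified with its input-output behaviour: A n xs is
  the set output after the points xs have been received, on a stream of total length n. The
  output may depend on n, which covers algorithms that know the length of the stream in
  advance; algorithms that do not are those for which A does not depend on n.
\<close>

type_synonym streaming_alg = "nat \<Rightarrow> real vec list \<Rightarrow> real vec set"

definition solves_streaming_ellipsoid :: "nat \<Rightarrow> streaming_alg \<Rightarrow> bool" where
  "solves_streaming_ellipsoid d A \<longleftrightarrow>
     (\<forall>n xs. xs \<noteq> [] \<and> length xs \<le> n \<and> set xs \<subseteq> carrier_vec d \<longrightarrow>
        ellipsoid d (A n xs) \<and> sym_hull d xs \<subseteq> A n xs)"

definition monotonic_alg :: "nat \<Rightarrow> streaming_alg \<Rightarrow> bool" where
  "monotonic_alg d A \<longleftrightarrow>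
     (\<forall>n xs x. xs \<noteq> [] \<and> length (xs @ [x]) \<le> n \<and> set (xs @ [x]) \<subseteq> carrier_vec d \<longrightarrow>
        A n xs \<subseteq> A n (xs @ [x]))"

text \<open>
  Only streams whose points span the whole space are considered, since otherwise the minimum
  volume ellipsoid is not well defined. The value is \<open>\<infinity>\<close> if no factor is achieved.
\<close>

definition approx_factor :: "nat \<Rightarrow> streaming_alg \<Rightarrow> ereal" where
  "approx_factor d A = Inf {ereal \<alpha> | \<alpha>. \<alpha> \<ge> 0 \<and>
     (\<forall>xs. set xs \<subseteq> carrier_vec d \<and> spanning d (set xs) \<longrightarrow>
        A (length xs) xs \<subseteq> (\<lambda>v. \<alpha> \<cdot>\<^sub>v v) ` min_volume_ellipsoid d (sym_hull d xs))}"

end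

theory Submission
  imports Defs
begin

text \<open>
  Take d to be a power of 2 and let u_1, ..., u_d be the rows of a normalized Hadamard
  matrix. After the standard unit vectors have been received, the current ellipsoid M B (B
  the unit ball) contains them, so the rows of M have norm at least 1, its squared Frobenius
  norm is at least d, and for some i the ellipsoid has extent at least 1 in direction u_i.
  The adversary now sends s u_i with s slightly larger than 1 / sqrt d, and R u_k with R
  large for the other k. The unit vectors lie in the ellipsoid J with semi-axes along these
  orthogonal points, and by Hadamard's inequality J is the unique ellipsoid of minimum
  volume containing the points. It has extent only s in direction u_i, whereas monotonicity
  keeps the extent of the algorithm's ellipsoid at least 1, so the factor is at least 1 / s.
\<close>

section \<open>Change of variables for lower triangular linear maps\<close>

text \<open>Tonelli's theorem splits off the last coordinate. With the other coordinates fixed, the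
  map acts on it affinely, so the inner integral is a substitution on the line and the outer one is
  the induction hypothesis. The sum over \<open>j\<le>i\<close> makes the map triangular whatever
  \<open>a\<close> is above the diagonal.\<close>

lemma nn_integral_lower_triangular:
  fixes a :: "nat \<Rightarrow> nat \<Rightarrow> real"
  assumes "f \<in> borel_measurable (\<Pi>\<^sub>M i\<in>{..<n}. lborel)" and "\<And>i. i < n \<Longrightarrow> a i i \<noteq> 0"
  shows "(\<integral>\<^sup>+x. f x \<partial>(\<Pi>\<^sub>M i\<in>{..<n}. lborel)) =
    ennreal (\<Prod>i<n. \<bar>a i i\<bar>) *
      (\<integral>\<^sup>+x. f (\<lambda>i\<in>{..<n}. \<Sum>j\<le>i. a i j * x j) \<partial>(\<Pi>\<^sub>M i\<in>{..<n}. lborel))"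
  using assms
proof (induction n arbitrary: f)
  case 0
  \<comment> \<open>The empty product measure is the counting measure on a single point, so both
    integrals are the value of \<open>f\<close> there.\<close>
  show ?case by (simp add: PiM_empty nn_integral_count_space_finite restrict_def)
next
  case (Suc n)
  interpret product_sigma_finite "\<lambda>_::nat. lborel :: real measure" ..
  let ?M = "\<lambda>n. (\<Pi>\<^sub>M i\<in>{..<n}. lborel) :: (nat \<Rightarrow> real) measure"
  let ?T = "\<lambda>n x. (\<lambda>i\<in>{..<n}. \<Sum>j\<le>i. a i j * x j) :: nat \<Rightarrow> real"
  define g where "g x = (\<integral>\<^sup>+y. f (x(n := y)) \<partial>lborel)" for x
  have f[measurable]: "f \<in> borel_measurable (\<Pi>\<^sub>M i\<in>insert n {..<n}. lborel)"
    using Suc.prems(1) by (simp add: lessThan_Suc)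
  have g: "g \<in> borel_measurable (?M n)"
    unfolding g_def by measurable
  have T: "?T (Suc n) \<in> measurable (\<Pi>\<^sub>M i\<in>insert n {..<n}. lborel) (\<Pi>\<^sub>M i\<in>insert n {..<n}. lborel)"
    unfolding lessThan_Suc
  proof (rule measurable_restrict)
    fix i assume i: "i \<in> insert n {..<n}"
    show "(\<lambda>x. \<Sum>j\<le>i. a i j * x j) \<in> measurable (\<Pi>\<^sub>M i\<in>insert n {..<n}. lborel) lborel"
    proof -
      have "(\<lambda>x. a i j * x j) \<in> borel_measurable (\<Pi>\<^sub>M i\<in>insert n {..<n}. lborel)" if "j \<le> i" for j
      proof -
        have "j \<in> insert n {..<n}" using i that by auto
        from measurable_component_singleton[OF this, of "\<lambda>_. lborel :: real measure"]
        show ?thesis by simp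
      qed
      then show ?thesis by simp
    qed
  qed
  have fT: "(\<lambda>x. f (?T (Suc n) x)) \<in> borel_measurable (\<Pi>\<^sub>M i\<in>insert n {..<n}. lborel)"
    using measurable_compose[OF T f] .
  have inner: "g (?T n x) = ennreal \<bar>a n n\<bar> * (\<integral>\<^sup>+y. f (?T (Suc n) (x(n := y))) \<partial>lborel)"
    if x: "x \<in> space (?M n)" for x
  proof -
    have Tn: "?T n x \<in> space (?M n)" by (auto simp: space_PiM)
    have fTn: "(\<lambda>y. f ((?T n x)(n := y))) \<in> borel_measurable borel"
    proof -
      have "(\<lambda>y. (?T n x)(n := y)) \<in> measurable lborel (\<Pi>\<^sub>M i\<in>insert n {..<n}. lborel)"
        by (rule measurable_fun_upd[where J="{..<n}"]) (use Tn in auto)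
      from measurable_compose[OF this f] show ?thesis by simp
    qed
    \<comment> \<open>Triangularity enters here: the first \<open>n\<close> coordinates of the image
      do not involve \<open>y\<close>, and the last one is affine in \<open>y\<close> with slope
      \<open>a n n\<close>.\<close>
    have "?T (Suc n) (x(n := y)) = (?T n x)(n := (\<Sum>j<n. a n j * x j) + a n n * y)" for y
      by (auto simp: fun_eq_iff restrict_def lessThan_Suc_atMost[symmetric] intro!: sum.cong)
    then show ?thesis
      unfolding g_def
      using nn_integral_real_affine[OF fTn, of "a n n" "\<Sum>j<n. a n j * x j"] Suc.prems(2)[of n]
      by (simp only: lessI simp_thms)
  qed
  have "(\<integral>\<^sup>+x. f x \<partial>?M (Suc n)) = (\<integral>\<^sup>+x. g x \<partial>?M n)"
    unfolding lessThan_Suc g_def by (rule product_nn_integral_insert) (use f in auto)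
  also have "\<dots> = ennreal (\<Prod>i<n. \<bar>a i i\<bar>) * (\<integral>\<^sup>+x. g (?T n x) \<partial>?M n)"
    using Suc.prems(2) by (intro Suc.IH g) auto
  also have "(\<integral>\<^sup>+x. g (?T n x) \<partial>?M n) =
      (\<integral>\<^sup>+x. ennreal \<bar>a n n\<bar> * (\<integral>\<^sup>+y. f (?T (Suc n) (x(n := y))) \<partial>lborel) \<partial>?M n)"
    by (intro nn_integral_cong inner)
  also have "\<dots> = ennreal \<bar>a n n\<bar> * (\<integral>\<^sup>+x. (\<integral>\<^sup>+y. f (?T (Suc n) (x(n := y))) \<partial>lborel) \<partial>?M n)"
    by (rule nn_integral_cmult) (use fT in measurable)
  also have "(\<integral>\<^sup>+x. (\<integral>\<^sup>+y. f (?T (Suc n) (x(n := y))) \<partial>lborel) \<partial>?M n) = (\<integral>\<^sup>+x. f (?T (Suc n) x) \<partial>?M (Suc n))"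
    unfolding lessThan_Suc[of n] by (rule product_nn_integral_insert[symmetric]) (use fT in \<open>auto simp: lessThan_Suc\<close>)
  finally show ?case
    by (simp only: prod.lessThan_Suc ennreal_mult[OF prod_nonneg abs_ge_zero] abs_ge_zero mult.assoc)
qed

section \<open>Triangularization by orthogonal matrices\<close>

lemma scalar_prod_self_pos:
  fixes v :: "real vec"
  assumes "v \<in> carrier_vec n" "v \<noteq> 0\<^sub>v n"
  shows "0 < v \<bullet> v"
proof -
  obtain i where i: "i < n" "v $ i \<noteq> 0"
    using assms by (metis carrier_vecD eq_vecI index_zero_vec(1) index_zero_vec(2))
  have "0 < (\<Sum>i<n. v $ i * v $ i)"
    using i by (intro sum_pos2[of _ i]) (auto simp: zero_less_mult_iff linorder_neq_iff)
  then show ?thesis using assms by (simp add: scalar_prod_def atLeast0LessThan)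
qed

lemma scalar_prod_self_nonneg: "0 \<le> (v :: real vec) \<bullet> v"
  by (auto simp: scalar_prod_def intro: sum_nonneg)

text \<open>The vectors \<open>q j\<close> are built downwards from \<open>j = n - 1\<close>, with
  \<open>k\<close> the last index reached. Each new one has to be orthogonal to \<open>k\<close>
  rows of \<open>M\<close> and to the \<open>n - 1 - k\<close> vectors already found, which leaves a
  nonzero choice even if \<open>M\<close> is singular.\<close>

lemma exists_orthonormal_triangularizing_rows:
  fixes M :: "real mat"
  assumes M: "M \<in> carrier_mat n n" and "k \<le> n"
  shows "\<exists>q. \<forall>j. k \<le> j \<and> j < n \<longrightarrow> q j \<in> carrier_vec n \<and> q j \<bullet> q j = 1 \<and>
    (\<forall>i<j. row M i \<bullet> q j = 0) \<and> (\<forall>l. j < l \<and> l < n \<longrightarrow> q l \<bullet> q j = 0)"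
  using \<open>k \<le> n\<close>
proof (induction k rule: inc_induct)
  case base
  show ?case by auto
next
  case (step k)
  then obtain q where q: "\<And>j. Suc k \<le> j \<Longrightarrow> j < n \<Longrightarrow> q j \<in> carrier_vec n \<and> q j \<bullet> q j = 1 \<and>
    (\<forall>i<j. row M i \<bullet> q j = 0) \<and> (\<forall>l. j < l \<and> l < n \<longrightarrow> q l \<bullet> q j = 0)"
    by blast
  \<comment> \<open>The conditions on the new row form n - 1 linear equations, so they are the kernel condition of
    a square matrix with a zero row.\<close>
  define c where "c = (\<lambda>i. if i < k then row M i else if i = k then 0\<^sub>v n else q i)"
  have c: "c i \<in> carrier_vec n" if "i < n" for i
    using that q[of i] M by (auto simp: c_def)
  \<comment> \<open>The repeated case distinction gives \<open>N\<close> the shape that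
    \<open>det_row_0\<close> expects.\<close>
  define N where "N = mat\<^sub>r n n (\<lambda>i. if i = k then 0\<^sub>v n else c i)"
  have N: "N \<in> carrier_mat n n" by (auto simp: N_def)
  have "det N = 0" unfolding N_def using \<open>k < n\<close> c by (intro det_row_0) auto
  then obtain v where v: "v \<in> carrier_vec n" "v \<noteq> 0\<^sub>v n" "N *\<^sub>v v = 0\<^sub>v n"
    using det_0_iff_vec_prod_zero[OF N] by blast
  have cv: "c i \<bullet> v = 0" if "i < n" for i
  proof (cases "i = k")
    case True
    then show ?thesis using v by (simp add: c_def)
  next
    case False
    have "(N *\<^sub>v v) $ i = row N i \<bullet> v" using that N by simp
    also have "row N i = c i" using that c[OF that] False by (simp add: N_def)
    finally show ?thesis using v that by simp
  qed
  define w where "w = (1 / sqrt (v \<bullet> v)) \<cdot>\<^sub>v v"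
  have w: "w \<in> carrier_vec n" using v by (simp add: w_def)
  have "w \<bullet> w = 1"
    using scalar_prod_self_pos[OF v(1,2)] v by (simp add: w_def field_simps)
  have cw: "c i \<bullet> w = 0" if "i < n" for i
    using cv[OF that] c[OF that] v by (simp add: w_def)
  let ?q = "q(k := w)"
  have "?q j \<in> carrier_vec n \<and> ?q j \<bullet> ?q j = 1 \<and>
    (\<forall>i<j. row M i \<bullet> ?q j = 0) \<and> (\<forall>l. j < l \<and> l < n \<longrightarrow> ?q l \<bullet> ?q j = 0)"
    if "k \<le> j" "j < n" for j
  proof (cases "j = k")
    case True
    have "row M i \<bullet> w = 0" if "i < k" for i
      using cw[of i] that \<open>k < n\<close> by (simp add: c_def)
    moreover have "q l \<bullet> w = 0" if "k < l" "l < n" for l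
      using cw[of l] that by (simp add: c_def)
    ultimately show ?thesis using True w \<open>w \<bullet> w = 1\<close> by auto
  next
    case False
    then show ?thesis using q[of j] that by auto
  qed
  then show ?case by blast
qed

text \<open>The LQ decomposition of a possibly singular matrix: with the \<open>q j\<close> as rows
  of \<open>Q\<close>, entry \<open>(i, j)\<close> of \<open>M * Q\<^sup>T\<close> is the scalar
  product of row \<open>i\<close> of \<open>M\<close> with \<open>q j\<close>.\<close>

lemma exists_orthogonal_triangularization:
  fixes M :: "real mat"
  assumes M: "M \<in> carrier_mat n n"
  shows "\<exists>Q \<in> carrier_mat n n. Q * Q\<^sup>T = 1\<^sub>m n \<and> (\<forall>i j. i < j \<longrightarrow> j < n \<longrightarrow> (M * Q\<^sup>T) $$ (i, j) = 0)"
proof -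
  obtain q where q: "\<And>j. j < n \<Longrightarrow> q j \<in> carrier_vec n \<and> q j \<bullet> q j = 1 \<and>
    (\<forall>i<j. row M i \<bullet> q j = 0) \<and> (\<forall>l. j < l \<and> l < n \<longrightarrow> q l \<bullet> q j = 0)"
    using exists_orthonormal_triangularizing_rows[OF M, of 0] by auto
  define Q where "Q = mat\<^sub>r n n q"
  have Q: "Q \<in> carrier_mat n n" by (simp add: Q_def)
  have row: "row Q i = q i" if "i < n" for i
    using q[OF that] that by (simp add: Q_def)
  have qq: "q i \<bullet> q j = (if i = j then 1 else 0)" if "i < n" "j < n" for i j
    using q[OF that(1)] q[OF that(2)] that comm_scalar_prod[of "q i" n "q j"] by (cases i j rule: linorder_cases) auto
  have "Q * Q\<^sup>T = 1\<^sub>m n"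
    using Q by (intro eq_matI) (auto simp: row qq)
  moreover have "(M * Q\<^sup>T) $$ (i, j) = 0" if "i < j" "j < n" for i j
    using q[of j] M Q that by (auto simp: row)
  ultimately show ?thesis using Q by auto
qed

section \<open>Volume of ellipsoids\<close>

lemma det_neq_0_obtain_inverse:
  fixes A :: "real mat"
  assumes "A \<in> carrier_mat n n" "det A \<noteq> 0"
  obtains B where "B \<in> carrier_mat n n" "A * B = 1\<^sub>m n" "B * A = 1\<^sub>m n"
  \<comment> \<open>A unit of the matrix ring has a two-sided inverse; \<open>()\<close> fills the
    record extension of the ring.\<close>
  using det_non_zero_imp_unit[OF assms, of "()"] by (auto simp: Units_def ring_mat_def)

lemma lower_triangular_det:
  fixes L :: "real mat"
  assumes "L \<in> carrier_mat n n" "\<And>i j. i < j \<Longrightarrow> j < n \<Longrightarrow> L $$ (i, j) = 0"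
  shows "det L = (\<Prod>i<n. L $$ (i, i))"
  using assms det_lower_triangular[of n L] by (simp add: prod_list_diag_prod atLeast0LessThan)

lemma abs_det_orthogonal:
  fixes Q :: "real mat"
  assumes "Q \<in> carrier_mat n n" "Q * Q\<^sup>T = 1\<^sub>m n"
  shows "\<bar>det Q\<bar> = 1"
proof -
  have "det Q * det Q = 1"
    using assms det_mult[of Q n "Q\<^sup>T"] by (simp add: det_transpose)
  then show ?thesis by (auto simp: square_eq_1_iff)
qed

lemma orthogonal_scalar_prod:
  fixes U :: "real mat"
  assumes "U \<in> carrier_mat n n" "U\<^sup>T * U = 1\<^sub>m n" "v \<in> carrier_vec n"
  shows "(U *\<^sub>v v) \<bullet> (U *\<^sub>v v) = v \<bullet> v"
proof -
  have "(U *\<^sub>v v) \<bullet> (U *\<^sub>v v) = v \<bullet> (U\<^sup>T *\<^sub>v (U *\<^sub>v v))"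
    using assms transpose_vec_mult_scalar[of U n n v "U *\<^sub>v v"]
      comm_scalar_prod[of "U\<^sup>T *\<^sub>v (U *\<^sub>v v)" n v] by simp
  also have "U\<^sup>T *\<^sub>v (U *\<^sub>v v) = v"
    using assms assoc_mult_mat_vec[of "U\<^sup>T" n n U n v] by simp
  finally show ?thesis .
qed

text \<open>Hence \<open>M\<close> and \<open>M * U\<close> describe the same ellipsoid, so the
  matrix of an ellipsoid may be changed by an orthogonal factor on the right.\<close>

lemma orthogonal_image_unit_ball:
  fixes U :: "real mat"
  assumes U: "U \<in> carrier_mat n n" "U\<^sup>T * U = 1\<^sub>m n"
  shows "(*\<^sub>v) U ` unit_ball_vec n = unit_ball_vec n"
proof
  show "(*\<^sub>v) U ` unit_ball_vec n \<subseteq> unit_ball_vec n"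
    using U by (auto simp: unit_ball_vec_def orthogonal_scalar_prod)
  have UU: "U * U\<^sup>T = 1\<^sub>m n"
    using U mat_mult_left_right_inverse[of "U\<^sup>T" n U] by simp
  show "unit_ball_vec n \<subseteq> (*\<^sub>v) U ` unit_ball_vec n"
  proof
    fix v :: "real vec" assume v: "v \<in> unit_ball_vec n"
    then have "U *\<^sub>v (U\<^sup>T *\<^sub>v v) = v"
      using U UU assoc_mult_mat_vec[of U n n "U\<^sup>T" n v] by (simp add: unit_ball_vec_def)
    moreover have "U\<^sup>T *\<^sub>v v \<in> unit_ball_vec n"
      using U UU v orthogonal_scalar_prod[of "U\<^sup>T" n v] by (simp add: unit_ball_vec_def)
    ultimately show "v \<in> (*\<^sub>v) U ` unit_ball_vec n" by (metis image_eqI)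
  qed
qed

lemma image_mult_mat_vec:
  fixes M N :: "real mat"
  assumes "M \<in> carrier_mat n n" "N \<in> carrier_mat n n" "S \<subseteq> carrier_vec n"
  shows "(*\<^sub>v) (M * N) ` S = (*\<^sub>v) M ` (*\<^sub>v) N ` S"
  unfolding image_image using assms by (intro image_cong) auto

lemma unit_ball_vec_carrier: "unit_ball_vec n \<subseteq> carrier_vec n"
  by (auto simp: unit_ball_vec_def)

text \<open>The condition is a polynomial inequality in the coordinates. With an inverse matrix for
  \<open>A\<close> it describes an ellipsoid, with the identity the ball itself.\<close>

lemma sets_preimage_unit_ball:
  fixes A :: "real mat"
  assumes A: "A \<in> carrier_mat d d"
  shows "{f \<in> {..<d} \<rightarrow>\<^sub>E UNIV. A *\<^sub>v vec d f \<in> unit_ball_vec d} \<in> sets (\<Pi>\<^sub>M i\<in>{..<d}. lborel)"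
proof -
  have "{f \<in> {..<d} \<rightarrow>\<^sub>E UNIV. A *\<^sub>v vec d f \<in> unit_ball_vec d} =
    {f \<in> space (\<Pi>\<^sub>M i\<in>{..<d}. lborel :: real measure). (\<Sum>i<d. (\<Sum>j<d. A $$ (i, j) * f j)\<^sup>2) \<le> 1}"
    using A by (auto simp: space_PiM unit_ball_vec_def scalar_prod_def power2_eq_square atLeast0LessThan)
  also have "\<dots> \<in> sets (\<Pi>\<^sub>M i\<in>{..<d}. lborel)"
  proof -
    have [measurable]: "(\<lambda>f. f j) \<in> borel_measurable (\<Pi>\<^sub>M i\<in>{..<d}. lborel :: real measure)" if "j \<in> {..<d}" for j
      using measurable_component_singleton[OF that, of "\<lambda>_. lborel :: real measure"] by simp
    show ?thesis by measurable
  qed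
  finally show ?thesis .
qed

text \<open>Comparing ellipsoids by their determinants means cancelling the volume of the ball. The
  ball is enclosed between two cubes.\<close>

lemma vec_volume_unit_ball_bounds:
  "vec_volume d (unit_ball_vec d) \<noteq> 0" "vec_volume d (unit_ball_vec d) \<noteq> \<infinity>"
proof -
  interpret product_sigma_finite "\<lambda>_::nat. lborel :: real measure" ..
  let ?M = "(\<Pi>\<^sub>M i\<in>{..<d}. lborel) :: (nat \<Rightarrow> real) measure"
  let ?B = "{f \<in> {..<d} \<rightarrow>\<^sub>E UNIV. vec d f \<in> unit_ball_vec d}"
  have B: "?B \<in> sets ?M" 
    using sets_preimage_unit_ball[of "1\<^sub>m d" d] by simp
  have sub: "?B \<subseteq> Pi\<^sub>E {..<d} (\<lambda>_. {-1..1})"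
  proof
    fix f assume "f \<in> ?B"
    then have ext: "f \<in> {..<d} \<rightarrow>\<^sub>E UNIV" and f: "(\<Sum>i<d. (f i)\<^sup>2) \<le> 1"
      by (auto simp: unit_ball_vec_def scalar_prod_def power2_eq_square atLeast0LessThan)
    show "f \<in> Pi\<^sub>E {..<d} (\<lambda>_. {-1..1})"
    proof (rule PiE_I)
      fix i assume i: "i \<in> {..<d}"
      have "(f i)\<^sup>2 \<le> (\<Sum>i<d. (f i)\<^sup>2)" using i by (intro member_le_sum) auto
      with f have "\<bar>f i\<bar> \<le> 1" by (simp add: abs_square_le_1[symmetric])
      then show "f i \<in> {-1..1}" by auto
    qed (rule PiE_arb[OF ext])
  qed
  have "Pi\<^sub>E {..<d} (\<lambda>_. {-1..1::real}) \<in> sets ?M"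
    by (rule sets_PiM_I_finite) auto
  with sub have "vec_volume d (unit_ball_vec d) \<le> emeasure ?M (Pi\<^sub>E {..<d} (\<lambda>_. {-1..1}))"
    unfolding vec_volume_def by (rule emeasure_mono)
  also have "\<dots> = (\<Prod>i<d. 2)" by (subst emeasure_PiM) auto
  also have "\<dots> < \<infinity>" by (simp add: power_eq_top_ennreal less_top[symmetric])
  finally show "vec_volume d (unit_ball_vec d) \<noteq> \<infinity>" by simp
  \<comment> \<open>Side \<open>1 / (d + 1)\<close> keeps the squared norm below
    \<open>d / (d + 1)^2\<close> and avoids a division by 0 when \<open>d = 0\<close>.\<close>
  have "Pi\<^sub>E {..<d} (\<lambda>_. {0..1 / real (d + 1)}) \<subseteq> ?B"
  proof
    fix f assume f: "f \<in> Pi\<^sub>E {..<d} (\<lambda>_. {0..1 / real (d + 1)})"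
    then have ext: "f \<in> {..<d} \<rightarrow>\<^sub>E UNIV" and "\<And>i. i < d \<Longrightarrow> 0 \<le> f i \<and> f i \<le> 1 / real (d + 1)"
      by (auto dest: PiE_mem simp: PiE_def)
    then have "(\<Sum>i<d. (f i)\<^sup>2) \<le> (\<Sum>i<d. (1 / real (d + 1))\<^sup>2)"
      by (intro sum_mono power_mono) auto
    also have "\<dots> = real d / (real d + 1)\<^sup>2" by (simp add: power_divide add.commute)
    also have "\<dots> \<le> 1" by (simp add: divide_le_eq power2_eq_square algebra_simps)
    finally show "f \<in> ?B" using ext
      by (simp add: unit_ball_vec_def scalar_prod_def power2_eq_square atLeast0LessThan)
  qed
  then have "emeasure ?M (Pi\<^sub>E {..<d} (\<lambda>_. {0..1 / real (d + 1)})) \<le> vec_volume d (unit_ball_vec d)"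
    unfolding vec_volume_def using B by (intro emeasure_mono)
  moreover have "emeasure ?M (Pi\<^sub>E {..<d} (\<lambda>_. {0..1 / real (d + 1)})) = (\<Prod>i<d. ennreal (1 / real (d + 1)))"
    by (subst emeasure_PiM) auto
  moreover have "(\<Prod>i<d. ennreal (1 / real (d + 1))) \<noteq> 0" by simp
  ultimately show "vec_volume d (unit_ball_vec d) \<noteq> 0" by auto
qed

text \<open>Passing to the triangular \<open>L = M * Q\<^sup>T\<close> changes neither the ellipsoid
  nor the modulus of the determinant, and for \<open>L\<close> the triangular change of variables
  applies.\<close>

lemma vec_volume_ellipsoid:
  fixes M :: "real mat"
  assumes M: "M \<in> carrier_mat d d" and det: "det M \<noteq> 0"
  shows "vec_volume d ((*\<^sub>v) M ` unit_ball_vec d) = ennreal \<bar>det M\<bar> * vec_volume d (unit_ball_vec d)"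
proof -
  let ?M = "(\<Pi>\<^sub>M i\<in>{..<d}. lborel) :: (nat \<Rightarrow> real) measure"
  obtain Q where Q: "Q \<in> carrier_mat d d" "Q * Q\<^sup>T = 1\<^sub>m d"
    and tri: "\<And>i j. i < j \<Longrightarrow> j < d \<Longrightarrow> (M * Q\<^sup>T) $$ (i, j) = 0"
    using exists_orthogonal_triangularization[OF M] by blast
  define L where "L = M * Q\<^sup>T"
  have L: "L \<in> carrier_mat d d" using M Q by (simp add: L_def)
  have image: "(*\<^sub>v) L ` unit_ball_vec d = (*\<^sub>v) M ` unit_ball_vec d"
    unfolding L_def using M Q
    by (simp add: image_mult_mat_vec[OF _ _ unit_ball_vec_carrier] orthogonal_image_unit_ball)
  have "\<bar>det Q\<bar> = 1" by (rule abs_det_orthogonal[OF Q])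
  then have detL: "\<bar>det L\<bar> = \<bar>det M\<bar>"
    using M Q by (simp add: L_def det_mult det_transpose abs_mult)
  have detL': "det L = (\<Prod>i<d. L $$ (i, i))"
    using L tri by (intro lower_triangular_det) (auto simp: L_def)
  have detL0: "det L \<noteq> 0" using det detL by auto
  have diag: "L $$ (i, i) \<noteq> 0" if "i < d" for i
    using detL0 that unfolding detL' by simp
  obtain K where K: "K \<in> carrier_mat d d" "L * K = 1\<^sub>m d" "K * L = 1\<^sub>m d"
    using det_neq_0_obtain_inverse[OF L detL0] by blast
  \<comment> \<open>The image under \<open>L\<close> is rewritten as a preimage under
    \<open>K\<close>, which gives its measurability.\<close>
  have LK: "v \<in> (*\<^sub>v) L ` unit_ball_vec d \<longleftrightarrow> K *\<^sub>v v \<in> unit_ball_vec d"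
    if v: "v \<in> carrier_vec d" for v
  proof
    assume "v \<in> (*\<^sub>v) L ` unit_ball_vec d"
    then obtain u where u: "u \<in> unit_ball_vec d" "v = L *\<^sub>v u" by auto
    then have "K *\<^sub>v v = u"
      using K L assoc_mult_mat_vec[of K d d L d u] by (simp add: unit_ball_vec_def)
    with u show "K *\<^sub>v v \<in> unit_ball_vec d" by simp
  next
    assume "K *\<^sub>v v \<in> unit_ball_vec d"
    moreover have "v = L *\<^sub>v (K *\<^sub>v v)"
      using K L v assoc_mult_mat_vec[of L d d K d v] by simp
    ultimately show "v \<in> (*\<^sub>v) L ` unit_ball_vec d" by blast
  qed
  let ?S = "{f \<in> {..<d} \<rightarrow>\<^sub>E UNIV. vec d f \<in> (*\<^sub>v) L ` unit_ball_vec d}"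
  let ?B = "{f \<in> {..<d} \<rightarrow>\<^sub>E UNIV. vec d f \<in> unit_ball_vec d}"
  let ?T = "\<lambda>x. (\<lambda>i\<in>{..<d}. \<Sum>j\<le>i. L $$ (i, j) * x j)"
  have S: "?S \<in> sets ?M"
    using sets_preimage_unit_ball[OF K(1)] by (simp add: LK)
  have B: "?B \<in> sets ?M"
    using sets_preimage_unit_ball[of "1\<^sub>m d" d] by simp
  have T: "vec d (?T x) = L *\<^sub>v vec d x" for x
  proof (rule eq_vecI)
    fix i assume "i < dim_vec (L *\<^sub>v vec d x)"
    then have i: "i < d" using L by simp
    have "(\<Sum>j\<le>i. L $$ (i, j) * x j) = (\<Sum>j<d. L $$ (i, j) * x j)"
      using i tri by (intro sum.mono_neutral_left) (auto simp: L_def[symmetric])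
    then show "vec d (?T x) $ i = (L *\<^sub>v vec d x) $ i"
      using i L by (simp add: scalar_prod_def atLeast0LessThan)
  qed (use L in simp)
  \<comment> \<open>After the substitution, the indicator of the ellipsoid becomes that of the
    ball.\<close>
  have "indicator ?S (?T x) = (indicator ?B x :: ennreal)" if "x \<in> space ?M" for x
  proof -
    have "K *\<^sub>v (L *\<^sub>v vec d x) = vec d x"
      using K L assoc_mult_mat_vec[of K d d L d "vec d x"] by simp
    then have "vec d (?T x) \<in> (*\<^sub>v) L ` unit_ball_vec d \<longleftrightarrow> vec d x \<in> unit_ball_vec d"
      using L by (simp only: T) (simp add: LK)
    then show ?thesis using that
      by (simp add: indicator_def space_PiM)
  qed
  then have "(\<integral>\<^sup>+x. indicator ?S (?T x) \<partial>?M) = (\<integral>\<^sup>+x. indicator ?B x \<partial>?M)"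
    by (intro nn_integral_cong)
  moreover have "(\<integral>\<^sup>+x. indicator ?S x \<partial>?M) =
      ennreal (\<Prod>i<d. \<bar>L $$ (i, i)\<bar>) * (\<integral>\<^sup>+x. indicator ?S (?T x) \<partial>?M)"
    using S diag by (intro nn_integral_lower_triangular) auto
  ultimately have "emeasure ?M ?S = ennreal (\<Prod>i<d. \<bar>L $$ (i, i)\<bar>) * emeasure ?M ?B"
    using S B by simp
  then show ?thesis
    by (simp add: vec_volume_def image[symmetric] detL[symmetric] detL' abs_prod)
qed

section \<open>Minimum volume ellipsoids\<close>

lemma abs_prod_ge_1_imp_all_eq_1:
  fixes f :: "'a \<Rightarrow> real"
  assumes "finite I" "\<And>i. i \<in> I \<Longrightarrow> \<bar>f i\<bar> \<le> 1" "1 \<le> \<bar>prod f I\<bar>" "i \<in> I"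
  shows "\<bar>f i\<bar> = 1"
proof -
  have "\<bar>prod f I\<bar> = \<bar>f i\<bar> * (\<Prod>i\<in>I - {i}. \<bar>f i\<bar>)"
    using assms by (simp add: prod.remove abs_mult abs_prod)
  also have "\<dots> \<le> \<bar>f i\<bar> * 1"
    using assms by (intro mult_left_mono prod_le_1) auto
  finally show ?thesis using assms(2)[OF assms(4)] assms(3) by simp
qed

text \<open>Rotating \<open>Z\<close> into a triangular \<open>T\<close> preserves the Gram matrix
  of the rows and the modulus of the determinant. The diagonal entries of \<open>T\<close> have
  modulus at most 1 and their product at least 1, so all have modulus 1. Each then exhausts the norm
  of its row, and the other entries vanish.\<close>

lemma hadamard_equality:
  fixes Z :: "real mat"
  assumes Z: "Z \<in> carrier_mat n n"
    and rows: "\<And>i. i < n \<Longrightarrow> row Z i \<bullet> row Z i \<le> 1"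
    and det: "1 \<le> \<bar>det Z\<bar>"
  shows "Z * Z\<^sup>T = 1\<^sub>m n" "\<bar>det Z\<bar> = 1"
proof -
  obtain Q where Q: "Q \<in> carrier_mat n n" "Q * Q\<^sup>T = 1\<^sub>m n"
    and tri: "\<And>i j. i < j \<Longrightarrow> j < n \<Longrightarrow> (Z * Q\<^sup>T) $$ (i, j) = 0"
    using exists_orthogonal_triangularization[OF Z] by blast
  have QQ: "Q\<^sup>T * Q = 1\<^sub>m n" using Q mat_mult_left_right_inverse[of Q n "Q\<^sup>T"] by simp
  define T where "T = Z * Q\<^sup>T"
  have T: "T \<in> carrier_mat n n" using Z Q by (simp add: T_def)
  have TT: "T * T\<^sup>T = Z * Z\<^sup>T"
  proof -
    have "T * T\<^sup>T = (Z * Q\<^sup>T) * (Q * Z\<^sup>T)"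
      using Z Q transpose_mult[of Z n n "Q\<^sup>T" n] by (simp add: T_def)
    also have "\<dots> = Z * (Q\<^sup>T * (Q * Z\<^sup>T))"
      using Z Q by (intro assoc_mult_mat) auto
    also have "Q\<^sup>T * (Q * Z\<^sup>T) = (Q\<^sup>T * Q) * Z\<^sup>T"
      using Z Q by (intro assoc_mult_mat[symmetric]) auto
    finally show ?thesis using QQ Z by simp
  qed
  have rowT: "(\<Sum>j<n. (T $$ (i, j))\<^sup>2) \<le> 1" if "i < n" for i
  proof -
    have "(T * T\<^sup>T) $$ (i, i) \<le> 1"
      unfolding TT using rows[OF that] Z that by simp
    then show ?thesis using T that
      by (simp add: scalar_prod_def power2_eq_square atLeast0LessThan)
  qed
  have "\<bar>det Q\<bar> = 1" by (rule abs_det_orthogonal[OF Q])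
  then have detT: "\<bar>det T\<bar> = \<bar>det Z\<bar>"
    using Z Q by (simp add: T_def det_mult det_transpose abs_mult)
  have detT': "det T = (\<Prod>i<n. T $$ (i, i))"
    using T tri by (intro lower_triangular_det) (auto simp: T_def)
  have le: "\<bar>T $$ (i, i)\<bar> \<le> 1" if "i \<in> {..<n}" for i
  proof -
    have "(T $$ (i, i))\<^sup>2 \<le> (\<Sum>j<n. (T $$ (i, j))\<^sup>2)" using that by (intro member_le_sum) auto
    with rowT[of i] that show ?thesis by (simp add: abs_square_le_1[symmetric])
  qed
  have diag: "\<bar>T $$ (i, i)\<bar> = 1" if "i < n" for i
    using abs_prod_ge_1_imp_all_eq_1[of "{..<n}" "\<lambda>i. T $$ (i, i)" i] le det detT detT' that by auto
  have off: "T $$ (i, j) = 0" if "i < n" "j < n" "i \<noteq> j" for i j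
  proof -
    have "(\<Sum>j<n. (T $$ (i, j))\<^sup>2) = (T $$ (i, i))\<^sup>2 + (\<Sum>j\<in>{..<n} - {i}. (T $$ (i, j))\<^sup>2)"
      using that by (simp add: sum.remove)
    moreover have "(T $$ (i, i))\<^sup>2 = 1" using diag[OF that(1)] by (metis power2_abs one_power2)
    moreover have "(T $$ (i, j))\<^sup>2 \<le> (\<Sum>j\<in>{..<n} - {i}. (T $$ (i, j))\<^sup>2)"
      using that by (intro member_le_sum) auto
    ultimately have "(T $$ (i, j))\<^sup>2 \<le> 0" using rowT[OF that(1)] by linarith
    then show ?thesis by simp
  qed
  have "T * T\<^sup>T = 1\<^sub>m n"
  proof (rule eq_matI)
    fix i j assume "i < dim_row (1\<^sub>m n :: real mat)" "j < dim_col (1\<^sub>m n :: real mat)"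
    then have ij: "i < n" "j < n" by auto
    have "(\<Sum>k<n. T $$ (i, k) * T $$ (j, k)) = (\<Sum>k<n. if k = i then T $$ (i, i) * T $$ (j, i) else 0)"
      using off ij by (intro sum.cong) auto
    also have "\<dots> = (if i = j then 1 else 0)"
      using ij off[of j i] diag[of i] by (auto simp: abs_if square_eq_1_iff split: if_splits)
    finally show "(T * T\<^sup>T) $$ (i, j) = 1\<^sub>m n $$ (i, j)"
      using ij T by (simp add: scalar_prod_def atLeast0LessThan)
  qed (use T in auto)
  with TT show "Z * Z\<^sup>T = 1\<^sub>m n" by simp
  show "\<bar>det Z\<bar> = 1" using diag by (simp add: detT[symmetric] detT' abs_prod)
qed

section \<open>Ellipsoids containing given points\<close>

lemma convex_ellipsoid:
  assumes "ellipsoid d E"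
  shows "convex_vec d E"
proof -
  obtain M where M: "M \<in> carrier_mat d d" and E: "E = (*\<^sub>v) M ` unit_ball_vec d"
    using assms by (auto simp: ellipsoid_def)
  have "u \<cdot>\<^sub>v (M *\<^sub>v x) + v \<cdot>\<^sub>v (M *\<^sub>v y) \<in> E"
    if x: "x \<in> unit_ball_vec d" and y: "y \<in> unit_ball_vec d" and uv: "u \<ge> 0" "v \<ge> 0" "u + v = 1"
    for x y u v
  proof -
    have c: "x \<in> carrier_vec d" "y \<in> carrier_vec d" and n: "x \<bullet> x \<le> 1" "y \<bullet> y \<le> 1"
      using x y by (auto simp: unit_ball_vec_def)
    \<comment> \<open>As both norms are at most 1, expanding this square bounds the mixed term as
      Cauchy-Schwarz would.\<close>
    have "0 \<le> (x - y) \<bullet> (x - y)" by (rule scalar_prod_self_nonneg)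
    also have "\<dots> = x \<bullet> x - 2 * (x \<bullet> y) + y \<bullet> y"
      using c comm_scalar_prod[of x d y]
      by (simp add: minus_scalar_prod_distrib[of _ d] scalar_prod_minus_distrib[of _ d])
    finally have "2 * (x \<bullet> y) \<le> 2" using n by linarith
    let ?w = "u \<cdot>\<^sub>v x + v \<cdot>\<^sub>v y"
    have "?w \<bullet> ?w = u * u * (x \<bullet> x) + u * v * (2 * (x \<bullet> y)) + v * v * (y \<bullet> y)"
      using c comm_scalar_prod[of x d y]
      by (simp add: add_scalar_prod_distrib[of _ d] scalar_prod_add_distrib[of _ d] algebra_simps)
    also have "\<dots> \<le> u * u * 1 + u * v * 2 + v * v * 1"
      using uv n \<open>2 * (x \<bullet> y) \<le> 2\<close> by (intro add_mono mult_left_mono) auto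
    also have "\<dots> = (u + v)\<^sup>2" by (simp add: power2_eq_square algebra_simps)
    finally have "?w \<in> unit_ball_vec d" using c uv by (simp add: unit_ball_vec_def)
    moreover have "M *\<^sub>v ?w = u \<cdot>\<^sub>v (M *\<^sub>v x) + v \<cdot>\<^sub>v (M *\<^sub>v y)"
      using M c by (simp add: mult_add_distrib_mat_vec[of _ d d] mult_mat_vec[of _ d d])
    ultimately show ?thesis unfolding E by (metis image_eqI)
  qed
  moreover have "E \<subseteq> carrier_vec d" using M by (auto simp: E unit_ball_vec_def)
  ultimately show ?thesis by (auto simp: convex_vec_def E)
qed

lemma uminus_mem_ellipsoid:
  assumes "ellipsoid d E" "v \<in> E"
  shows "- v \<in> E"
proof -
  obtain M x where M: "M \<in> carrier_mat d d" and E: "E = (*\<^sub>v) M ` unit_ball_vec d"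
    and x: "x \<in> unit_ball_vec d" "v = M *\<^sub>v x"
    using assms by (auto simp: ellipsoid_def)
  have "- x \<in> unit_ball_vec d" using x by (simp add: unit_ball_vec_def)
  moreover have "- v = M *\<^sub>v (- x)"
    using x M by (intro eq_vecI) (auto simp: unit_ball_vec_def)
  ultimately show ?thesis unfolding E by blast
qed

text \<open>Ellipsoids are convex and centrally symmetric, so containing the hull reduces to
  containing the points.\<close>

lemma sym_hull_subset_ellipsoid_iff:
  assumes "ellipsoid d E"
  shows "sym_hull d xs \<subseteq> E \<longleftrightarrow> set xs \<subseteq> E"
proof
  assume "sym_hull d xs \<subseteq> E"
  then show "set xs \<subseteq> E"
    using hull_subset[of "set xs \<union> uminus ` set xs" "convex_vec d"] by (auto simp: sym_hull_def)
next
  assume "set xs \<subseteq> E"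
  then show "sym_hull d xs \<subseteq> E"
    unfolding sym_hull_def
    using assms uminus_mem_ellipsoid by (intro hull_minimal convex_ellipsoid) auto
qed

text \<open>Writing each column of \<open>P\<close> as \<open>L\<close> applied to a vector of the
  ball gives \<open>P = L * Z\<^sup>T\<close> with rows of \<open>Z\<close> of norm at most 1.
  Hadamard's inequality bounds \<open>det Z\<close>, and its equality case makes \<open>Z\<close>
  orthogonal, so that \<open>L\<close> and \<open>P\<close> have the same ellipsoid.\<close>

lemma ellipsoid_containing_columns:
  fixes P L :: "real mat"
  assumes P: "P \<in> carrier_mat d d" "det P \<noteq> 0" and L: "L \<in> carrier_mat d d"
    and cols: "\<And>k. k < d \<Longrightarrow> col P k \<in> (*\<^sub>v) L ` unit_ball_vec d"
  shows "det L \<noteq> 0" and "\<bar>det P\<bar> \<le> \<bar>det L\<bar>"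
    and "\<bar>det L\<bar> \<le> \<bar>det P\<bar> \<Longrightarrow> (*\<^sub>v) L ` unit_ball_vec d = (*\<^sub>v) P ` unit_ball_vec d"
proof -
  obtain y where y: "\<And>k. k < d \<Longrightarrow> y k \<in> unit_ball_vec d \<and> col P k = L *\<^sub>v y k"
    using cols unfolding image_iff by metis
  define Z where "Z = mat\<^sub>r d d y"
  have Z: "Z \<in> carrier_mat d d" by (simp add: Z_def)
  have row: "row Z k = y k" if "k < d" for k
    using y[OF that] that by (simp add: Z_def unit_ball_vec_def)
  have PLZ: "P = L * Z\<^sup>T"
  proof (rule eq_matI)
    fix i k assume "i < dim_row (L * Z\<^sup>T)" "k < dim_col (L * Z\<^sup>T)"
    then have ik: "i < d" "k < d" using L Z by auto
    then have "P $$ (i, k) = col P k $ i" using P by simp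
    also have "\<dots> = (L *\<^sub>v y k) $ i" using y ik by simp
    also have "\<dots> = (L * Z\<^sup>T) $$ (i, k)" using ik L Z by (simp add: row)
    finally show "P $$ (i, k) = (L * Z\<^sup>T) $$ (i, k)" .
  qed (use P L Z in auto)
  have rows: "row Z i \<bullet> row Z i \<le> 1" if "i < d" for i
    using y[OF that] by (simp add: row that unit_ball_vec_def)
  have det: "det P = det L * det Z"
    using L Z by (simp add: PLZ det_mult[of _ d] det_transpose[of _ d])
  with P show L0: "det L \<noteq> 0" by auto
  \<comment> \<open>A modulus above 1 would meet the hypothesis of \<open>hadamard_equality\<close>,
    which then forces it to be 1.\<close>
  have "\<bar>det Z\<bar> \<le> 1"
    using hadamard_equality(2)[OF Z rows] by linarith
  then show "\<bar>det P\<bar> \<le> \<bar>det L\<bar>" by (simp add: det abs_mult mult_left_le)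
  assume "\<bar>det L\<bar> \<le> \<bar>det P\<bar>"
  with L0 have "1 \<le> \<bar>det Z\<bar>" by (simp add: det abs_mult)
  then have "Z * Z\<^sup>T = 1\<^sub>m d" using hadamard_equality(1)[OF Z rows] by blast
  then show "(*\<^sub>v) L ` unit_ball_vec d = (*\<^sub>v) P ` unit_ball_vec d"
    using L Z by (simp add: PLZ image_mult_mat_vec[OF _ _ unit_ball_vec_carrier] orthogonal_image_unit_ball)
qed

text \<open>Every competitor contains the columns of \<open>P\<close>, so it is not flat and volumes
  compare as determinants do. The equality case gives the uniqueness that the definite description
  requires.\<close>

lemma min_volume_ellipsoid_eq:
  fixes P :: "real mat"
  assumes P: "P \<in> carrier_mat d d" "det P \<noteq> 0"
    and cols: "\<And>k. k < d \<Longrightarrow> col P k \<in> set xs"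
    and sub: "set xs \<subseteq> (*\<^sub>v) P ` unit_ball_vec d"
  shows "min_volume_ellipsoid d (sym_hull d xs) = (*\<^sub>v) P ` unit_ball_vec d"
proof -
  let ?J = "(*\<^sub>v) P ` unit_ball_vec d"
  let ?V = "vec_volume d (unit_ball_vec d)"
  have J: "ellipsoid d ?J" using P by (auto simp: ellipsoid_def)
  have min: "vec_volume d ?J \<le> vec_volume d E \<and> (vec_volume d E \<le> vec_volume d ?J \<longrightarrow> E = ?J)"
    if E: "ellipsoid d E" "sym_hull d xs \<subseteq> E" for E
  proof -
    obtain L where L: "L \<in> carrier_mat d d" and EL: "E = (*\<^sub>v) L ` unit_ball_vec d"
      using E by (auto simp: ellipsoid_def)
    have "col P k \<in> (*\<^sub>v) L ` unit_ball_vec d" if "k < d" for k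
      using E cols[OF that] by (auto simp: sym_hull_subset_ellipsoid_iff EL[symmetric])
    note * = ellipsoid_containing_columns[OF P L this]
    have "ennreal \<bar>det L\<bar> * ?V \<le> ennreal \<bar>det P\<bar> * ?V \<longleftrightarrow> \<bar>det L\<bar> \<le> \<bar>det P\<bar>"
      using vec_volume_unit_ball_bounds[of d]
      by (simp add: mult.commute[of _ ?V] ennreal_mult_le_mult_iff)
    then show ?thesis
      using * P L by (auto simp: EL vec_volume_ellipsoid intro!: mult_right_mono ennreal_leI)
  qed
  show ?thesis
    unfolding min_volume_ellipsoid_def
  proof (rule the_equality)
    show "is_min_volume_ellipsoid d (sym_hull d xs) ?J"
      using J sub min by (auto simp: is_min_volume_ellipsoid_def sym_hull_subset_ellipsoid_iff)
    fix E assume "is_min_volume_ellipsoid d (sym_hull d xs) E"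
    then show "E = ?J"
      using J sub min[of E] by (auto simp: is_min_volume_ellipsoid_def sym_hull_subset_ellipsoid_iff)
  qed
qed

section \<open>Hadamard matrices and the lower bound\<close>

text \<open>Sylvester's doubling construction, with a factor \<open>1 / sqrt 2\<close> at each step
  to keep the rows orthonormal.\<close>

lemma exists_normalized_hadamard:
  "\<exists>U \<in> carrier_mat (2 ^ k) (2 ^ k). U * U\<^sup>T = 1\<^sub>m (2 ^ k) \<and>
    (\<forall>i < 2 ^ k. \<forall>j < 2 ^ k. (U $$ (i, j))\<^sup>2 = 1 / (2 ^ k :: real))"
proof (induction k)
  case 0
  show ?case by (intro bexI[of _ "1\<^sub>m 1"]) auto
next
  case (Suc k)
  let ?n = "2 ^ k :: nat"
  obtain U :: "real mat" where U: "U \<in> carrier_mat ?n ?n" "U * U\<^sup>T = 1\<^sub>m ?n"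
    and entries: "\<And>i j. i < ?n \<Longrightarrow> j < ?n \<Longrightarrow> (U $$ (i, j))\<^sup>2 = 1 / 2 ^ k"
    using Suc.IH by blast
  define W where "W = (1 / sqrt 2) \<cdot>\<^sub>m U"
  have W: "W \<in> carrier_mat ?n ?n" using U by (simp add: W_def)
  have WW: "W * W\<^sup>T = (1 / 2) \<cdot>\<^sub>m 1\<^sub>m ?n"
  proof -
    have "W\<^sup>T = (1 / sqrt 2) \<cdot>\<^sub>m U\<^sup>T" by (intro eq_matI) (auto simp: W_def)
    moreover have "row U i \<bullet> row U j = 1\<^sub>m ?n $$ (i, j)" if "i < ?n" "j < ?n" for i j
      using that U by (simp flip: U(2))
    ultimately show ?thesis
      using U by (intro eq_matI) (auto simp: W_def)
  qed
  let ?X = "four_block_mat W W W (- W)"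
  have X: "?X \<in> carrier_mat (2 ^ Suc k) (2 ^ Suc k)"
    using W by (simp add: mult_2)
  have "?X * ?X\<^sup>T = four_block_mat W W W (- W) * four_block_mat (W\<^sup>T) (W\<^sup>T) (W\<^sup>T) ((- W)\<^sup>T)"
    using W by (subst transpose_four_block_mat[of _ ?n ?n _ ?n _ ?n]) auto
  also have "\<dots> = four_block_mat (W * W\<^sup>T + W * W\<^sup>T) (W * W\<^sup>T + W * (- W)\<^sup>T)
      (W * W\<^sup>T + (- W) * W\<^sup>T) (W * W\<^sup>T + (- W) * (- W)\<^sup>T)"
    using W by (intro mult_four_block_mat) auto
  also have "W * W\<^sup>T + W * W\<^sup>T = 1\<^sub>m ?n"
    unfolding WW by (intro eq_matI) auto
  also have "W * W\<^sup>T + W * (- W)\<^sup>T = 0\<^sub>m ?n ?n"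
    using W by (intro eq_matI) auto
  also have "W * W\<^sup>T + (- W) * W\<^sup>T = 0\<^sub>m ?n ?n"
    using W by (intro eq_matI) auto
  also have "W * W\<^sup>T + (- W) * (- W)\<^sup>T = W * W\<^sup>T + W * W\<^sup>T"
    using W by (intro eq_matI) auto
  also have "W * W\<^sup>T + W * W\<^sup>T = 1\<^sub>m ?n"
    unfolding WW by (intro eq_matI) auto
  finally have "?X * ?X\<^sup>T = 1\<^sub>m (2 ^ Suc k)" by (simp add: mult_2)
  moreover have "(?X $$ (i, j))\<^sup>2 = 1 / 2 ^ Suc k" if "i < 2 ^ Suc k" "j < 2 ^ Suc k" for i j
  proof -
    have *: "(W $$ (i, j))\<^sup>2 = 1 / 2 ^ Suc k" "i < ?n \<Longrightarrow> j < ?n \<Longrightarrow> ((- W) $$ (i, j))\<^sup>2 = 1 / 2 ^ Suc k"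
      if "i < ?n" "j < ?n" for i j
      using entries[OF that] that U W by (auto simp: W_def power_mult_distrib power_divide)
    \<comment> \<open>One instance of the entry formula for each block; indices in the second half
      are shifted by \<open>?n\<close>.\<close>
    show ?thesis
      using that W *[of "i - ?n" "j - ?n"] *[of i "j - ?n"] *[of "i - ?n" j] *[of i j] by (auto simp: Let_def)
  qed
  ultimately show ?case using X by blast
qed

lemma exists_large_row_of_orthogonal_mult:
  fixes M U :: "real mat"
  assumes "0 < d" and M: "M \<in> carrier_mat d d"
    and unit_vecs: "\<And>j. j < d \<Longrightarrow> unit_vec d j \<in> (*\<^sub>v) M ` unit_ball_vec d"
    and U: "U \<in> carrier_mat d d" "U * U\<^sup>T = 1\<^sub>m d"
  shows "\<exists>i<d. 1 \<le> row (U * M) i \<bullet> row (U * M) i"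
  \<comment> \<open>The squared row norms of M are at least 1 and their sum is invariant under U.\<close>
proof (rule ccontr)
  assume neg: "\<not> ?thesis"
  have UU: "U\<^sup>T * U = 1\<^sub>m d" using U mat_mult_left_right_inverse[of U d "U\<^sup>T"] by simp
  \<comment> \<open>The squared Frobenius norm is also counted by columns, because left
    multiplication by \<open>U\<close> acts on each column as an isometry.\<close>
  have sum_rows: "(\<Sum>i<d. row A i \<bullet> row A i) = (\<Sum>j<d. col A j \<bullet> col A j)"
    if "A \<in> carrier_mat d d" for A :: "real mat"
    using that sum.swap[of "\<lambda>i j. A $$ (i, j) * A $$ (i, j)" "{..<d}" "{..<d}"]
    by (simp add: scalar_prod_def atLeast0LessThan)
  have "1 \<le> row M j \<bullet> row M j" if j: "j < d" for j
  proof -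
    obtain y :: "real vec" where y: "y \<in> carrier_vec d" "y \<bullet> y \<le> 1" "unit_vec d j = M *\<^sub>v y"
      using unit_vecs[OF j] by (auto simp: unit_ball_vec_def)
    have "row M j \<bullet> y = unit_vec d j $ j" using y j M by simp
    then have one: "row M j \<bullet> y = 1" using j by simp
    have r: "row M j \<in> carrier_vec d" using M by auto
    have "0 \<le> (row M j - y) \<bullet> (row M j - y)" by (rule scalar_prod_self_nonneg)
    also have "\<dots> = row M j \<bullet> row M j - 2 * (row M j \<bullet> y) + y \<bullet> y"
      using r y comm_scalar_prod[of "row M j" d y]
      by (simp add: minus_scalar_prod_distrib[of _ d] scalar_prod_minus_distrib[of _ d])
    finally show ?thesis using y one by linarith
  qed
  then have "(\<Sum>j<d. 1) \<le> (\<Sum>j<d. row M j \<bullet> row M j)" by (intro sum_mono) auto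
  also have "\<dots> = (\<Sum>j<d. col M j \<bullet> col M j)" by (rule sum_rows[OF M])
  also have "\<dots> = (\<Sum>j<d. col (U * M) j \<bullet> col (U * M) j)"
    using M U UU
    by (intro sum.cong) (auto simp: col_mult2[of U d d M d] orthogonal_scalar_prod simp del: col_mult)
  also have "\<dots> = (\<Sum>i<d. row (U * M) i \<bullet> row (U * M) i)"
    using M U by (intro sum_rows[symmetric]) auto
  also have "\<dots> < (\<Sum>i<d. 1)"
    using neg \<open>0 < d\<close> by (intro sum_strict_mono) auto
  finally show False by simp
qed

section \<open>The adversarial stream\<close>

text \<open>Makes the adversary's stream one of those over which \<open>approx_factor\<close>
  quantifies.\<close>

lemma spanning_if_unit_vecs:
  assumes "set (unit_vecs d) \<subseteq> S" "S \<subseteq> carrier_vec d"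
  shows "spanning d S"
proof -
  interpret vec_space "TYPE(real)" d .
  show ?thesis
    unfolding spanning_def
    using span_is_monotone[OF assms(1)] span_is_subset2[of S] assms(2) span_unit_vecs_is_carrier
    by auto
qed

text \<open>Monotonicity is iterated with the announced length \<open>n\<close> held fixed, since it
  compares only outputs for the same \<open>n\<close>.\<close>

lemma monotonic_alg_append:
  assumes A: "monotonic_alg d A" and xs: "xs \<noteq> []"
  shows "length (xs @ ys) \<le> n \<Longrightarrow> set (xs @ ys) \<subseteq> carrier_vec d \<Longrightarrow> A n xs \<subseteq> A n (xs @ ys)"
proof (induction ys rule: rev_induct)
  case Nil
  then show ?case by simp
next
  case (snoc y ys)
  then have "A n xs \<subseteq> A n (xs @ ys)" by simp
  also have "\<dots> \<subseteq> A n ((xs @ ys) @ [y])"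
    using A xs snoc.prems unfolding monotonic_alg_def by (metis append_assoc append_is_Nil_conv)
  finally show ?case by simp
qed

lemma col_mem_ellipsoid:
  fixes P :: "real mat"
  assumes "P \<in> carrier_mat d d" "k < d"
  shows "col P k \<in> (*\<^sub>v) P ` unit_ball_vec d"
proof
  show "col P k = P *\<^sub>v unit_vec d k"
    using assms by (intro eq_vecI) auto
  show "unit_vec d k \<in> unit_ball_vec d"
    using assms by (simp add: unit_ball_vec_def)
qed

lemma approx_factor_hadamard_dimension:
  assumes A: "solves_streaming_ellipsoid d A" "monotonic_alg d A" and "0 < d"
    and U: "U \<in> carrier_mat d d" "U * U\<^sup>T = 1\<^sub>m d"
    and entries: "\<And>i j. i < d \<Longrightarrow> j < d \<Longrightarrow> (U $$ (i, j))\<^sup>2 = 1 / real d"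
  shows "ereal (sqrt (real d)) \<le> approx_factor d A"
  unfolding approx_factor_def
proof (rule Inf_greatest, safe)
  fix \<alpha> :: real
  assume "0 \<le> \<alpha>"
  assume approx: "\<forall>xs. set xs \<subseteq> carrier_vec d \<and> spanning d (set xs) \<longrightarrow>
    A (length xs) xs \<subseteq> (\<cdot>\<^sub>v) \<alpha> ` min_volume_ellipsoid d (sym_hull d xs)"
  have "sqrt d \<le> \<alpha>"
  proof (rule ccontr)
    assume "\<not> sqrt d \<le> \<alpha>"
    then have \<alpha>: "\<alpha> < sqrt d" by simp
    \<comment> \<open>The reciprocal of the midpoint between \<open>\<alpha>\<close> and
      \<open>sqrt d\<close>, so that \<open>\<alpha> * s < 1 < sqrt d * s\<close>.\<close>
    define s where "s = 2 / (\<alpha> + sqrt d)"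
    \<comment> \<open>\<open>t\<close> is what the short semi-axis \<open>s\<close> contributes to
      the squared norm of a unit vector measured in the ellipsoid \<open>J\<close>; \<open>R\<close>
      is chosen so that the long ones add at most the remaining \<open>1 - t\<close>.\<close>
    define t where "t = 1 / (d * s\<^sup>2)"
    define R where "R = 1 / sqrt (1 - t)"
    have s: "0 < s" "\<alpha> * s < 1" "1 < sqrt d * s"
      using \<open>0 \<le> \<alpha>\<close> \<alpha> by (auto simp: s_def divide_simps add_nonneg_eq_0_iff)
    have "1 < (sqrt d * s)\<^sup>2" using s(3) by (simp add: one_less_power)
    then have "t < 1" by (auto simp: t_def power_mult_distrib divide_less_eq_1)
    then have R: "0 < R" "1 / R\<^sup>2 = 1 - t" by (auto simp: R_def power_divide)
    have Urow: "row U i \<bullet> row U j = (if i = j then 1 else 0)" if "i < d" "j < d" for i j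
    proof -
      have "row U i \<bullet> row U j = (U * U\<^sup>T) $$ (i, j)" using that U(1) by simp
      also have "\<dots> = (if i = j then 1 else 0)" unfolding U(2) using that by simp
      finally show ?thesis .
    qed
    have uv: "set (unit_vecs d) = unit_vec d ` {..<d}"
      by (auto simp: unit_vecs_def)
    have ne: "unit_vecs d \<noteq> ([] :: real vec list)"
      using \<open>0 < d\<close> by (simp add: unit_vecs_def)
    have luv: "length (unit_vecs d :: real vec list) = d" by (simp add: unit_vecs_def)
    have uc: "set (unit_vecs d :: real vec list) \<subseteq> carrier_vec d" by (rule unit_vecs_carrier)
    \<comment> \<open>The announced length \<open>2 * d\<close> is the same for every later choice
      of direction, so this output is settled before the adversary chooses.\<close>
    have "ellipsoid d (A (2 * d) (unit_vecs d))" and in_hull: "sym_hull d (unit_vecs d) \<subseteq> A (2 * d) (unit_vecs d)"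
      using A(1) ne luv uc by (auto simp: solves_streaming_ellipsoid_def)
    then obtain M where M: "M \<in> carrier_mat d d"
      and AM: "A (2 * d) (unit_vecs d) = (*\<^sub>v) M ` unit_ball_vec d"
      and ell: "ellipsoid d (A (2 * d) (unit_vecs d))"
      by (auto simp: ellipsoid_def)
    have unit_in: "unit_vec d j \<in> (*\<^sub>v) M ` unit_ball_vec d" if "j < d" for j
    proof -
      have "set (unit_vecs d) \<subseteq> A (2 * d) (unit_vecs d)"
        using in_hull by (simp only: sym_hull_subset_ellipsoid_iff[OF ell])
      then show ?thesis using that by (auto simp: AM uv)
    qed
    obtain i where i: "i < d" and large: "1 \<le> row (U * M) i \<bullet> row (U * M) i"
      using exists_large_row_of_orthogonal_mult[OF \<open>0 < d\<close> M unit_in U] by blast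
    \<comment> \<open>The adversary appends the points D k u_k, where u_k is row k of U: short along the direction
      in which the algorithm's ellipsoid already has extent at least 1, long along all others.
      Since the entries of U are equal in modulus and s > 1 / sqrt d, R can be taken so large that the
      unit vectors still lie in the ellipsoid with these semi-axes.\<close>
    define D where "D = (\<lambda>k. if k = i then s else R)"
    have D: "0 < D k" for k using s R by (simp add: D_def)
    define P where "P = mat d d (\<lambda>(a, k). U $$ (k, a) * D k)"
    \<comment> \<open>The inverse of \<open>P\<close>: column \<open>j\<close> of \<open>Y\<close>
      is the vector that \<open>P\<close> maps to unit vector \<open>j\<close>.\<close>
    define Y where "Y = mat d d (\<lambda>(k, j). U $$ (k, j) / D k)"
    have P: "P \<in> carrier_mat d d" and Y: "Y \<in> carrier_mat d d" by (auto simp: P_def Y_def)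
    have colP: "col P k = D k \<cdot>\<^sub>v row U k" if "k < d" for k
      using U that by (intro eq_vecI) (auto simp: P_def)
    have PY: "P * Y = 1\<^sub>m d"
    proof -
      have "P * Y = U\<^sup>T * U"
        using D U by (intro eq_matI) (auto simp: P_def Y_def scalar_prod_def less_imp_neq[THEN not_sym] intro!: sum.cong)
      then show ?thesis using U mat_mult_left_right_inverse[of U d "U\<^sup>T"] by simp
    qed
    then have "det P * det Y = 1" using det_mult[OF P Y] by simp
    then have detP: "det P \<noteq> 0" by auto
    have "unit_vec d j \<in> (*\<^sub>v) P ` unit_ball_vec d" if j: "j < d" for j
    proof
      have "unit_vec d j = col (P * Y) j" using j by (simp add: PY)
      also have "\<dots> = P *\<^sub>v col Y j" by (rule col_mult2[OF P Y j])
      finally show "unit_vec d j = P *\<^sub>v col Y j" .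
      \<comment> \<open>As all entries of \<open>U\<close> have square \<open>1 / d\<close>, this
        norm does not depend on \<open>j\<close> or on the chosen \<open>i\<close>.\<close>
      have "col Y j \<bullet> col Y j = (\<Sum>k<d. (U $$ (k, j))\<^sup>2 / (D k)\<^sup>2)"
        using j by (simp add: Y_def scalar_prod_def power2_eq_square atLeast0LessThan)
      also have "\<dots> = (\<Sum>k<d. 1 / d / (D k)\<^sup>2)"
        using entries j by simp
      also have "\<dots> = 1 / d / s\<^sup>2 + (\<Sum>k\<in>{..<d} - {i}. 1 / d / R\<^sup>2)"
        using i by (subst sum.remove[of _ i]) (auto simp: D_def)
      also have "\<dots> = t + (real d - 1) / d * (1 / R\<^sup>2)"
        using i by (simp add: t_def of_nat_diff)
      also have "\<dots> \<le> t + 1 * (1 / R\<^sup>2)"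
        using \<open>0 < d\<close> by (intro add_left_mono mult_right_mono) (auto simp: divide_le_eq)
      also have "\<dots> = 1" using R by simp
      finally show "col Y j \<in> unit_ball_vec d" using Y by (auto simp: unit_ball_vec_def)
    qed
    then have E_sub: "set (unit_vecs d) \<subseteq> (*\<^sub>v) P ` unit_ball_vec d" by (auto simp: uv)
    define xs where "xs = unit_vecs d @ cols P"
    have set_xs: "set xs = set (unit_vecs d) \<union> col P ` {..<d}"
      using P by (auto simp: xs_def cols_def)
    have len: "length xs = 2 * d" using P by (simp add: xs_def luv)
    have carrier: "set xs \<subseteq> carrier_vec d"
      using P uc by (auto simp: set_xs)
    have J: "min_volume_ellipsoid d (sym_hull d xs) = (*\<^sub>v) P ` unit_ball_vec d"
      using E_sub col_mem_ellipsoid[OF P]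
      by (intro min_volume_ellipsoid_eq[OF P detP]) (auto simp: set_xs)
    have "A (2 * d) (unit_vecs d) \<subseteq> A (2 * d) xs"
      using monotonic_alg_append[OF A(2) ne, of "cols P" "2 * d"] len carrier by (simp add: xs_def)
    also have "\<dots> \<subseteq> (\<cdot>\<^sub>v) \<alpha> ` (*\<^sub>v) P ` unit_ball_vec d"
      using approx carrier spanning_if_unit_vecs[OF _ carrier] unfolding len[symmetric] J[symmetric]
      by (simp add: set_xs)
    finally have sub: "(*\<^sub>v) M ` unit_ball_vec d \<subseteq> (\<cdot>\<^sub>v) \<alpha> ` (*\<^sub>v) P ` unit_ball_vec d"
      by (simp add: AM)
    define w where "w = row (U * M) i"
    have w: "w \<in> carrier_vec d" using M U i by (auto simp: w_def)
    have ww: "1 \<le> w \<bullet> w" using large by (simp add: w_def)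
    \<comment> \<open>The point of the ball at which \<open>M *\<^sub>v y\<close> reaches farthest
      in direction \<open>row U i\<close>, namely to the norm of \<open>w\<close>.\<close>
    define y where "y = (1 / sqrt (w \<bullet> w)) \<cdot>\<^sub>v w"
    have y: "y \<in> unit_ball_vec d"
      using w ww by (simp add: y_def unit_ball_vec_def)
    then obtain z where z: "z \<in> unit_ball_vec d" and eq: "M *\<^sub>v y = \<alpha> \<cdot>\<^sub>v (P *\<^sub>v z)"
      using sub by blast
    have yz: "y \<in> carrier_vec d" "z \<in> carrier_vec d" using y z by (auto simp: unit_ball_vec_def)
    have row_apply: "row U i \<bullet> (N *\<^sub>v v) = row (U * N) i \<bullet> v"
      if "N \<in> carrier_mat d d" "v \<in> carrier_vec d" for N v
    proof -
      have "row U i \<bullet> (N *\<^sub>v v) = (U *\<^sub>v (N *\<^sub>v v)) $ i" using U i by simp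
      also have "\<dots> = ((U * N) *\<^sub>v v) $ i" using U that by (simp add: assoc_mult_mat_vec[of U d d N d v])
      also have "\<dots> = row (U * N) i \<bullet> v" using U i by simp
      finally show ?thesis .
    qed
    have "1 \<le> sqrt (w \<bullet> w)" using ww by simp
    also have "sqrt (w \<bullet> w) = w \<bullet> y"
      using w ww by (simp add: y_def real_div_sqrt)
    also have "\<dots> = row U i \<bullet> (M *\<^sub>v y)"
      using row_apply[OF M yz(1)] by (simp add: w_def)
    also have "\<dots> = \<alpha> * (row (U * P) i \<bullet> z)"
      using row_apply[OF P yz(2)] U P yz by (simp add: eq)
    also have "row (U * P) i \<bullet> z = (\<Sum>k<d. if k = i then s * z $ i else 0)"
    proof -
      \<comment> \<open>By orthonormality of the rows of \<open>U\<close>, row \<open>i\<close> of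
        \<open>U * P\<close> is \<open>s\<close> times a unit vector: the extent of \<open>J\<close>
        in direction \<open>row U i\<close> is only \<open>s\<close>.\<close>
      have "row (U * P) i $ k = (if k = i then s else 0)" if "k < d" for k
        using that i U P Urow colP by (simp add: D_def)
      then show ?thesis using yz(2) unfolding scalar_prod_def atLeast0LessThan
        by (intro sum.cong) auto
    qed
    also have "\<dots> = s * z $ i" using i by simp
    finally have "1 \<le> \<alpha> * s * z $ i" by simp
    moreover have "z $ i \<le> 1"
    proof -
      have "(z $ i)\<^sup>2 \<le> (\<Sum>k<d. (z $ k)\<^sup>2)" using i by (intro member_le_sum) auto
      also have "\<dots> \<le> 1" using z by (auto simp: unit_ball_vec_def scalar_prod_def power2_eq_square atLeast0LessThan)
      finally have "\<bar>z $ i\<bar> \<le> 1" by (simp add: abs_square_le_1[symmetric])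
      then show ?thesis by simp
    qed
    then have "\<alpha> * s * z $ i \<le> \<alpha> * s * 1"
      using \<open>0 \<le> \<alpha>\<close> s(1) by (intro mult_left_mono) auto
    ultimately show False using s(2) by simp
  qed
  then show "ereal (sqrt (real d)) \<le> ereal \<alpha>" by simp
qed

theorem theorem22:
  shows "infinite {d::nat. \<forall>A. solves_streaming_ellipsoid d A \<and> monotonic_alg d A \<longrightarrow>
           approx_factor d A \<ge> ereal (sqrt (real d))}"
proof (rule infinite_super)
  show "infinite (range (\<lambda>k. 2 ^ k :: nat))"
    by (rule range_inj_infinite) (simp add: inj_on_def)
  show "range (\<lambda>k. 2 ^ k) \<subseteq> {d. \<forall>A. solves_streaming_ellipsoid d A \<and> monotonic_alg d A \<longrightarrow>
           approx_factor d A \<ge> ereal (sqrt (real d))}"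
  proof safe
    fix k A
    assume A: "solves_streaming_ellipsoid (2 ^ k) A" "monotonic_alg (2 ^ k) A"
    obtain U :: "real mat" where "U \<in> carrier_mat (2 ^ k) (2 ^ k)" "U * U\<^sup>T = 1\<^sub>m (2 ^ k)"
      "\<And>i j. i < 2 ^ k \<Longrightarrow> j < 2 ^ k \<Longrightarrow> (U $$ (i, j))\<^sup>2 = 1 / real (2 ^ k)"
      using exists_normalized_hadamard[of k] by auto
    then show "ereal (sqrt (real (2 ^ k))) \<le> approx_factor (2 ^ k) A"
      by (intro approx_factor_hadamard_dimension[OF A]) auto
  qed
qed

end
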